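(* Let $\mathbb{F}$ be any field, let $m\le n$, and let $G=([m]\cup[n],E)$ be a bipartite graph with $E\subseteq[m]\times[n]$. Let $\mathcal{S}_G=\langle \mathrm{E}_{i,j}\mid (i,j)\in E\rangle\le \mathrm{M}(m\times n,\mathbb{F})$. Then for each $r\in[m]$, the maximum number of edges of a spanning subgraph of $G$ whose matching number is at most $r$ equals the largest dimension of a linear subspace of $\mathcal{S}_G$ in which every matrix has rank at most $r$.
   Context: $\mathrm{E}_{i,j}$ denotes the $m\times n$ matrix with $1$ in position $(i,j)$ and $0$ elsewhere. A spanning subgraph of $G$ has the same vertex set and an edge set contained in $E$. A matching is a set of edges no two of which share a vertex; the matching number is the maximum size of a matching. *)

theory Defs
  imports "HOL-Analysis.Analysis"
begin

section \<open>Bipartite graphs and matchings\<close>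

text \<open>
  A bipartite graph on the disjoint union of [m] and [n] is given by its edge set
  \<open>E :: ('m \<times> 'n) set\<close>, where the finite types \<open>'m\<close> and \<open>'n\<close> stand for [m] and [n]. Its vertex
  set is all of \<open>'m + 'n\<close>; in particular isolated vertices are present, and every subset of \<open>E\<close>
  is the edge set of a spanning subgraph.
\<close>

definition endpoints :: "'m \<times> 'n \<Rightarrow> ('m + 'n) set" where
  "endpoints e = {Inl (fst e), Inr (snd e)}"

definition spanning_subgraph :: "('m \<times> 'n) set \<Rightarrow> ('m \<times> 'n) set \<Rightarrow> bool" where
  "spanning_subgraph H E \<longleftrightarrow> H \<subseteq> E"

definition matching_in :: "('m \<times> 'n) set \<Rightarrow> ('m \<times> 'n) set \<Rightarrow> bool" where
  "matching_in M E \<longleftrightarrow> M \<subseteq> E \<and> pairwise (\<lambda>e f. disjnt (endpoints e) (endpoints f)) M"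

definition matching_number :: "('m::finite \<times> 'n::finite) set \<Rightarrow> nat" where
  "matching_number E = Max {card M | M. matching_in M E}"

lemma matching_number_set:
  fixes E :: "('m::finite \<times> 'n::finite) set"
  shows "finite {card M | M. matching_in M E}" "{card M | M. matching_in M E} \<noteq> {}"
proof -
  show "finite {card M | M. matching_in M E}"
    by simp
  have "matching_in {} E"
    by (simp add: matching_in_def)
  then show "{card M | M. matching_in M E} \<noteq> {}"
    by blast
qed


section \<open>The vector space of matrices over a field\<close>

text \<open>
  \<open>'a ^ 'n ^ 'm\<close> is the type of matrices with rows indexed by \<open>'m\<close> and columns indexed by \<open>'n\<close>.
  The library's \<open>*\<^sub>R\<close> covers only real scalars and \<open>*s\<close> would multiply a matrix by a vector of
  scalars, so scalar multiplication of matrices over an arbitrary field is introduced here.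
\<close>

definition mscale :: "'a::field \<Rightarrow> 'a ^ 'n ^ 'm \<Rightarrow> 'a ^ 'n ^ 'm" where
  "mscale c A = (\<chi> i j. c * A $ i $ j)"

interpretation mspace: vector_space "mscale :: 'a::field \<Rightarrow> 'a ^ 'n ^ 'm \<Rightarrow> 'a ^ 'n ^ 'm"
  by unfold_locales (simp_all add: mscale_def vec_eq_iff algebra_simps)

definition elem_mat :: "'m \<Rightarrow> 'n \<Rightarrow> 'a::field ^ 'n ^ 'm" where
  "elem_mat i j = (\<chi> k l. if k = i \<and> l = j then 1 else 0)"

definition graph_space :: "('m \<times> 'n) set \<Rightarrow> ('a::field ^ 'n ^ 'm) set" where
  "graph_space E = mspace.span {elem_mat i j | i j. (i, j) \<in> E}"


text \<open>
  The two families of numbers maximised in the theorem are finite and nonempty, so \<open>Max\<close> is a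
  genuine maximum on them.
\<close>

lemma subgraph_sizes_finite_nonempty:
  fixes E :: "('m::finite \<times> 'n::finite) set"
  shows "finite {card H | H. spanning_subgraph H E \<and> matching_number H \<le> r}" (is "finite ?S")
    and "{card H | H. spanning_subgraph H E \<and> matching_number H \<le> r} \<noteq> {}"
proof -
  show "finite ?S"
    by simp
  have "matching_in M ({} :: ('m \<times> 'n) set) \<longleftrightarrow> M = {}" for M
    by (auto simp: matching_in_def)
  then have "matching_number ({} :: ('m \<times> 'n) set) = 0"
    by (simp add: matching_number_def)
  moreover have "spanning_subgraph {} E"
    by (simp add: spanning_subgraph_def)
  ultimately show "?S \<noteq> {}"
    by (metis (mono_tags, lifting) empty_Collect_eq zero_le)
qed

lemma bounded_rank_dims_finite_nonempty:
  fixes E :: "('m::finite \<times> 'n::finite) set"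
  defines "D \<equiv> \<lambda>r. {mspace.dim W | W :: ('a::field ^ 'n ^ 'm) set.
                 mspace.subspace W \<and> W \<subseteq> graph_space E \<and> (\<forall>A\<in>W. rank A \<le> r)}"
  shows "finite (D r)" and "D r \<noteq> {}"
proof -
  let ?B = "{elem_mat i j | i j. (i, j) \<in> E} :: ('a ^ 'n ^ 'm) set"
  have "?B = (\<lambda>(i, j). elem_mat i j) ` E"
    by auto
  then have fin: "finite ?B"
    by simp
  have "mspace.dim W \<le> card ?B" if "W \<subseteq> graph_space E" for W :: "('a ^ 'n ^ 'm) set"
    using that fin unfolding graph_space_def by (rule mspace.dim_le_card)
  then have "D r \<subseteq> {..card ?B}"
    unfolding D_def by blast
  then show "finite (D r)"
    by (rule finite_subset) simp
  have "rows (0 :: 'a ^ 'n ^ 'm) \<subseteq> vec.span {}"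
    unfolding vec.span_empty by (auto simp: rows_def row_def vec_eq_iff)
  then have "rank (0 :: 'a ^ 'n ^ 'm) \<le> card ({} :: ('a ^ 'n) set)"
    unfolding row_rank_def_gen by (rule vec.dim_le_card) simp
  then have "\<forall>A\<in>{0 :: 'a ^ 'n ^ 'm}. rank A \<le> r"
    by simp
  moreover have "mspace.subspace {0 :: 'a ^ 'n ^ 'm}"
    by (rule mspace.subspace_single_0)
  moreover have "{0 :: 'a ^ 'n ^ 'm} \<subseteq> graph_space E"
    by (simp add: graph_space_def mspace.span_zero)
  ultimately show "D r \<noteq> {}"
    unfolding D_def by blast
qed

end

theory Submission
  imports Defs
begin

text \<open>
  If \<open>H\<close> has matching number at most \<open>r\<close>, then the matrices supported on \<open>H\<close> have rank at most
  \<open>r\<close>, because a nonvanishing minor has a nonvanishing term in its Leibniz expansion and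
  hence gives a matching. Conversely, following Meshulam, send a nonzero matrix to the
  lexicographically first position of its support. The positions obtained from a space \<open>W\<close> of
  matrices supported on \<open>E\<close> form a subgraph of \<open>E\<close> with at least \<open>dim W\<close> edges. Given a matching
  of leading positions, attained at matrices \<open>A\<^sub>1, \<dots>, A\<^sub>k\<close> of \<open>W\<close>, a suitable subset sum of the
  \<open>A\<^sub>s\<close> has rank at least \<open>k\<close>. Only coefficients 0 and 1 are used, so the field may be
  arbitrarily small.
\<close>

section \<open>Matchings and ranks\<close>

text \<open>\<open>Inl\<close> and \<open>Inr\<close> vertices never coincide, so two edges are
  disjoint exactly when both coordinates differ.\<close>

lemma matching_in_iff:
  fixes M :: "('m \<times> 'n) set"
  shows "matching_in M E \<longleftrightarrow> M \<subseteq> E \<and> inj_on fst M \<and> inj_on snd M"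
proof -
  have "disjnt (endpoints e) (endpoints f) \<longleftrightarrow> fst e \<noteq> fst f \<and> snd e \<noteq> snd f"
    for e f :: "'m \<times> 'n"
    by (auto simp: endpoints_def)
  then show ?thesis
    unfolding matching_in_def pairwise_def inj_on_def by (simp only:) blast
qed

lemma matching_number_le_iff:
  "matching_number E \<le> r \<longleftrightarrow> (\<forall>M. matching_in M E \<longrightarrow> card M \<le> r)"
  unfolding matching_number_def Max_le_iff[OF matching_number_set] by blast

text \<open>Extended to a basis, \<open>S\<close> becomes the rows of an invertible matrix; a
  nonzero Leibniz term of its determinant picks a nonzero entry in each row, in distinct
  columns.\<close>

lemma independent_system_of_positions:
  fixes S :: "('a::field ^ 'n) set"
  assumes "vec.independent S"
  obtains f where "inj_on f S" "\<And>v. v \<in> S \<Longrightarrow> v $ f v \<noteq> 0"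
proof -
  obtain B where B: "S \<subseteq> B" "vec.independent B" "vec.span B = UNIV"
    using vec.maximal_independent_subset_extend[OF subset_UNIV assms] by (metis top.extremum_uniqueI)
  have fB: "finite B"
    using B(2) by (rule vec.finiteI_independent)
  have "card B = CARD('n)"
    using vec.dim_eq_card[of B UNIV] B by (simp add: card_cart_basis)
  then obtain g :: "'n \<Rightarrow> 'a ^ 'n" where g: "bij_betw g UNIV B"
    using fB finite_same_card_bij[of "UNIV :: 'n set" B] by auto
  define A where "A = (\<chi> i. g i)"
  have "rows A = B"
    using g by (auto simp: rows_def row_def A_def bij_betw_def)
  then have "invertible A"
    using B(3) matrix_left_invertible_span_rows_gen[of A] by (metis invertible_left_inverse)
  then have "det A \<noteq> 0"
    by (simp add: invertible_det_nz)
  then obtain p where p: "p permutes UNIV" "(\<Prod>i\<in>UNIV. A $ i $ p i) \<noteq> 0"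
    unfolding det_def by (metis (mono_tags, lifting) mem_Collect_eq mult_zero_right sum.not_neutral_contains_not_neutral)
  show thesis
  proof
    have "inj_on (inv g) S"
      using g B(1) by (metis bij_betw_def inj_on_inv_into)
    then show "inj_on (p \<circ> inv g) S"
      using p(1) by (meson comp_inj_on inj_on_subset permutes_inj subset_UNIV)
    show "v $ (p \<circ> inv g) v \<noteq> 0" if "v \<in> S" for v
    proof -
      have "g (inv g v) = v"
        using that B(1) g by (metis bij_betw_def f_inv_into_f subsetD)
      moreover have "A $ inv g v $ p (inv g v) \<noteq> 0"
        using p(2) by simp
      ultimately show ?thesis
        by (simp add: A_def)
    qed
  qed
qed

lemma rank_le_matching_number:
  fixes A :: "'a::field ^ 'n ^ 'm"
  assumes supp: "\<And>i j. A $ i $ j \<noteq> 0 \<Longrightarrow> (i, j) \<in> H"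
  shows "rank A \<le> matching_number H"
proof -
  obtain S where S: "S \<subseteq> rows A" "vec.independent S" "card S = vec.dim (rows A)"
    using vec.basis_exists[of "rows A"] by metis
  obtain f where f: "inj_on f S" "\<And>v. v \<in> S \<Longrightarrow> v $ f v \<noteq> 0"
    using independent_system_of_positions[OF S(2)] by blast
  \<comment> \<open>\<open>S\<close> is a set of vectors and rows may repeat, so one row index is
    chosen per vector.\<close>
  have "\<exists>i. A $ i = v" if "v \<in> S" for v
    using that S(1) by (auto simp: rows_def row_def)
  then obtain i where i: "\<And>v. v \<in> S \<Longrightarrow> A $ i v = v"
    by metis
  have "inj_on i S"
    using i by (metis inj_onI)
  then have "inj_on fst ((\<lambda>v. (i v, f v)) ` S)" "inj_on snd ((\<lambda>v. (i v, f v)) ` S)"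
    using f(1) by (auto simp: inj_on_def)
  moreover have "(i v, f v) \<in> H" if "v \<in> S" for v
    using f(2) i supp that by metis
  ultimately have "matching_in ((\<lambda>v. (i v, f v)) ` S) H"
    by (auto simp: matching_in_iff)
  then have "card ((\<lambda>v. (i v, f v)) ` S) \<le> matching_number H"
    using matching_number_le_iff by blast
  moreover have "inj_on (\<lambda>v. (i v, f v)) S"
    using f(1) by (auto simp: inj_on_def)
  ultimately show ?thesis
    using S(3) by (simp add: card_image row_rank_def_gen)
qed

lemma card_le_rank:
  fixes A :: "'a::field ^ 'n ^ 'm"
  assumes "inj_on (($) A) R" "vec.independent (($) A ` R)"
  shows "card R \<le> rank A"
proof -
  have "($) A ` R \<subseteq> rows A"
    by (auto simp: rows_def row_def)
  then have "card (($) A ` R) \<le> vec.dim (rows A)"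
    using assms(2) vec.independent_card_le_dim by blast
  then show ?thesis
    using assms(1) by (simp add: card_image row_rank_def_gen)
qed


section \<open>Matrices supported on a graph\<close>

lemma graph_space_support:
  fixes A :: "'a::field ^ 'n ^ 'm"
  assumes "A \<in> graph_space E" "A $ i $ j \<noteq> 0"
  shows "(i, j) \<in> E"
proof -
  let ?U = "{A :: 'a ^ 'n ^ 'm. \<forall>i j. (i, j) \<notin> E \<longrightarrow> A $ i $ j = 0}"
  have "mspace.subspace ?U"
    by (auto simp: mspace.subspace_def mscale_def)
  moreover have "{elem_mat i j | i j. (i, j) \<in> E} \<subseteq> ?U"
    by (auto simp: elem_mat_def)
  ultimately have "graph_space E \<subseteq> ?U"
    unfolding graph_space_def by (intro mspace.span_minimal)
  then show ?thesis
    using assms by blast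
qed

text \<open>The generators are independent: a generator in the span of the others would be supported
  on \<open>E\<close> without its own edge.\<close>

lemma dim_graph_space:
  fixes E :: "('m::finite \<times> 'n::finite) set"
  shows "mspace.dim (graph_space E :: ('a::field ^ 'n ^ 'm) set) = card E"
proof -
  let ?e = "\<lambda>(i, j). elem_mat i j :: 'a ^ 'n ^ 'm"
  have img: "{elem_mat i j | i j. (i, j) \<in> F} = ?e ` F" for F :: "('m \<times> 'n) set"
    by auto
  have inj: "inj ?e"
    by (rule injI) (auto simp: elem_mat_def vec_eq_iff split: if_splits, metis+)
  have "mspace.independent (?e ` E)"
    unfolding mspace.dependent_def
  proof clarify
    fix i j assume "elem_mat i j \<in> mspace.span (?e ` E - {elem_mat i j :: 'a ^ 'n ^ 'm})"
    also have "?e ` E - {elem_mat i j} = ?e ` (E - {(i, j)})"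
      using inj by (auto simp: inj_on_def)
    finally have "(elem_mat i j :: 'a ^ 'n ^ 'm) \<in> graph_space (E - {(i, j)})"
      by (simp only: graph_space_def img)
    from graph_space_support[OF this, of i j] show False
      by (simp add: elem_mat_def)
  qed
  then have "mspace.dim (mspace.span (?e ` E)) = card (?e ` E)"
    by (rule mspace.dim_span_eq_card_independent)
  then show ?thesis
    unfolding graph_space_def img using inj by (simp add: card_image inj_on_subset[OF inj])
qed


section \<open>Leading positions\<close>

text \<open>Exchange step for families. Injectivity is carried along because independence of the
  image set does not see repeated vectors.\<close>

lemma independent_family_replace:
  fixes v :: "'i \<Rightarrow> 'a::field ^ 'n"
  assumes "t \<in> R" "inj_on v R" "vec.independent (v ` R)"
    and "w \<notin> vec.span (v ` (R - {t}))"
  shows "inj_on (v(t := w)) R \<and> vec.independent (v(t := w) ` R)"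
proof
  have "w \<notin> v ` (R - {t})"
    using assms(4) by (metis vec.span_base)
  then show "inj_on (v(t := w)) R"
    using assms(2) by (auto simp: inj_on_def)
  have "vec.independent (v ` (R - {t}))"
    using assms(3) by (rule vec.independent_mono) blast
  then have "vec.independent (insert w (v ` (R - {t})))"
    using assms(4) by (rule vec.independent_insertI[rotated])
  moreover have "v(t := w) ` R = insert w (v ` (R - {t}))"
    using assms(1) by auto
  ultimately show "vec.independent (v(t := w) ` R)"
    by simp
qed

lemma echelon_independent:
  fixes v :: "'i \<Rightarrow> 'a::field ^ 'n" and g :: "'n \<Rightarrow> nat"
  assumes "finite R" "inj g" "inj_on c R"
    and "\<And>i. i \<in> R \<Longrightarrow> v i $ c i \<noteq> 0"
    and "\<And>i j. i \<in> R \<Longrightarrow> g j < g (c i) \<Longrightarrow> v i $ j = 0"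
  shows "inj_on v R \<and> vec.independent (v ` R)"
  using assms(1,3-)
\<comment> \<open>The sign makes vectors enter by decreasing leading coordinate, so all earlier ones
  vanish at \<open>c t\<close> while \<open>v t\<close> does not.\<close>
proof (induction R rule: finite_ranking_induct[where f = "\<lambda>i. - int (g (c i))"])
  case empty
  then show ?case
    by (simp add: vec.independent_empty)
next
  case (insert t R)
  have IH: "inj_on v R \<and> vec.independent (v ` R)"
    using insert.prems by (intro insert.IH) auto
  show ?case
  proof (cases "t \<in> R")
    case True
    then show ?thesis
      using IH by (simp add: insert_absorb)
  next
    case False
    have "v i $ c t = 0" if "i \<in> R" for i
    proof -
      have "c i \<noteq> c t"
        using that False insert.prems(1) by (metis inj_onD insertI1 insertI2)
      then have "g (c t) < g (c i)"
        using insert.hyps(2)[OF that] assms(2) by (metis inj_eq le_neq_implies_less neg_le_iff_le of_nat_le_iff)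
      then show ?thesis
        using that insert.prems(3) by blast
    qed
    then have "v ` R \<subseteq> {x. x $ c t = 0}"
      by auto
    moreover have "vec.subspace {x :: 'a ^ 'n. x $ c t = 0}"
      by (simp add: vec.subspace_def)
    ultimately have "vec.span (v ` R) \<subseteq> {x. x $ c t = 0}"
      by (rule vec.span_minimal)
    then have nin: "v t \<notin> vec.span (v ` R)"
      using insert.prems(2) by blast
    then have "v t \<notin> v ` R"
      by (metis vec.span_base)
    then have "inj_on v (insert t R)"
      using IH by auto
    then show ?thesis
      using vec.independent_insertI[OF nin] IH by simp
  qed
qed

text \<open>
  The rows \<open>A i $ i\<close> are replaced one after the other, in the order of \<open>h\<close>, by the rows of the
  subset sum. When \<open>t\<close> is treated, including \<open>A t\<close> in the sum does not affect the earlier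
  rows, and adds \<open>A t $ t\<close> to row \<open>t\<close>. Since \<open>A t $ t\<close> is not in the span of
  the other vectors, one of the two choices keeps the family independent.
\<close>
lemma subset_sum_independent_rows:
  fixes A :: "'m::finite \<Rightarrow> 'a::field ^ 'n ^ 'm" and h :: "'m \<Rightarrow> nat"
  assumes "inj h"
    and zero: "\<And>s i. s \<in> R \<Longrightarrow> h i < h s \<Longrightarrow> A s $ i = 0"
    and diag: "inj_on (\<lambda>i. A i $ i) R" "vec.independent ((\<lambda>i. A i $ i) ` R)"
  shows "\<exists>X\<subseteq>R. inj_on (($) (sum A X)) R \<and> vec.independent (($) (sum A X) ` R)"
proof -
  \<comment> \<open>Stage \<open>n\<close> of the replacement: stage 0 is the independent diagonal
    family.\<close>
  define v where "v n X i = (if h i < n then sum A X $ i else A i $ i)" for n X i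
  have "\<exists>X\<subseteq>{i\<in>R. h i < n}. inj_on (v n X) R \<and> vec.independent (v n X ` R)" for n
  proof (induction n)
    case 0
    then show ?case
      using diag by (simp add: v_def)
  next
    case (Suc n)
    then obtain X where X: "X \<subseteq> {i\<in>R. h i < n}" "inj_on (v n X) R" "vec.independent (v n X ` R)"
      by blast
    show ?case
    proof (cases "\<exists>t\<in>R. h t = n")
      case False
      then have "v (Suc n) X i = v n X i" if "i \<in> R" for i
        using that by (auto simp: v_def less_Suc_eq)
      then have "inj_on (v (Suc n) X) R \<and> vec.independent (v (Suc n) X ` R)"
        using X(2,3) by (simp cong: image_cong inj_on_cong)
      then show ?thesis
        using X(1) by (intro exI[of _ X]) auto
    next
      case True
      then obtain t where t: "t \<in> R" "h t = n"
        by blast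
      have ht: "h i = n \<longleftrightarrow> i = t" for i
        using assms(1) t(2) by (auto simp: inj_eq)
      have tX: "t \<notin> X"
        using X(1) t(2) by auto
      let ?L = "vec.span (v n X ` (R - {t}))"
      have step: "v (Suc n) Y = (v n X)(t := sum A Y $ t)" if "Y = X \<or> Y = insert t X" for Y
      proof
        fix i
        have "sum A Y $ i = sum A X $ i" if "h i < n"
          using that \<open>Y = X \<or> Y = insert t X\<close> zero[OF t(1), of i] tX t(2) by auto
        then show "v (Suc n) Y i = ((v n X)(t := sum A Y $ t)) i"
          using ht by (auto simp: v_def less_Suc_eq)
      qed
      have "A t $ t \<notin> ?L"
      proof -
        have "v n X ` (R - {t}) = v n X ` R - {v n X t}"
          using X(2) t(1) by (auto simp: inj_on_def)
        moreover have "v n X t = A t $ t"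
          using t(2) by (simp add: v_def)
        ultimately show ?thesis
          using X(3) t(1) by (metis imageI vec.dependent_def)
      qed
      \<comment> \<open>If both candidate rows lay in \<open>?L\<close>, so would their difference
        \<open>A t $ t\<close>.\<close>
      moreover have "sum A (insert t X) $ t - sum A X $ t = A t $ t"
        using tX by simp
      ultimately obtain Y where Y: "Y = X \<or> Y = insert t X" "sum A Y $ t \<notin> ?L"
        using vec.span_diff by metis
      have "inj_on (v (Suc n) Y) R \<and> vec.independent (v (Suc n) Y ` R)"
        unfolding step[OF Y(1)] using t(1) X(2,3) Y(2) by (rule independent_family_replace)
      moreover have "Y \<subseteq> {i\<in>R. h i < Suc n}"
        using X(1) Y(1) t by auto
      ultimately show ?thesis
        by blast
    qed
  qed
  \<comment> \<open>This stage exceeds every value of \<open>h\<close>, so all rows have been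
    replaced.\<close>
  then obtain X where X: "X \<subseteq> R"
    "inj_on (v (Suc (Max (range h))) X) R" "vec.independent (v (Suc (Max (range h))) X ` R)"
    by blast
  have "v (Suc (Max (range h))) X = ($) (sum A X)"
    by (auto simp: v_def less_Suc_eq_le)
  then show ?thesis
    using X by auto
qed

text \<open>The key \<open>k\<close> encodes the order on positions. The value at the zero matrix is
  unspecified, so 0 is excluded below.\<close>

definition lead_pos :: "('m \<times> 'n \<Rightarrow> nat) \<Rightarrow> 'a::field ^ 'n ^ 'm \<Rightarrow> 'm \<times> 'n" where
  "lead_pos k A = arg_min k (\<lambda>(i, j). A $ i $ j \<noteq> 0)"

lemma lead_pos:
  assumes "A \<noteq> 0"
  shows "A $ fst (lead_pos k A) $ snd (lead_pos k A) \<noteq> 0"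
    and "k (i, j) < k (lead_pos k A) \<Longrightarrow> A $ i $ j = 0"
proof -
  obtain i' j' where *: "case (i', j') of (i, j) \<Rightarrow> A $ i $ j \<noteq> 0"
    using assms by (auto simp: vec_eq_iff)
  show "A $ fst (lead_pos k A) $ snd (lead_pos k A) \<noteq> 0"
    using arg_min_natI[of "\<lambda>(i, j). A $ i $ j \<noteq> 0", OF *, of k]
    by (simp add: lead_pos_def case_prod_beta)
  show "A $ i $ j = 0" if "k (i, j) < k (lead_pos k A)"
    using that arg_min_nat_le[of "\<lambda>(i, j). A $ i $ j \<noteq> 0" "(i, j)" k]
    by (auto simp: lead_pos_def)
qed

text \<open>Gaussian elimination: one matrix of \<open>W\<close> per leading position suffices to
  span \<open>W\<close>, since subtracting a multiple of the representative either gives 0 or moves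
  the leading position strictly later.\<close>

lemma dim_le_card_lead_pos:
  fixes W :: "('a::field ^ 'n::finite ^ 'm::finite) set"
  assumes W: "mspace.subspace W" and "inj k"
  shows "mspace.dim W \<le> card (lead_pos k ` (W - {0}))"
proof -
  let ?P = "lead_pos k ` (W - {0})"
  have "\<exists>A. A \<in> W - {0} \<and> lead_pos k A = q" if "q \<in> ?P" for q
    using that by blast
  then obtain B where B: "\<And>q. q \<in> ?P \<Longrightarrow> B q \<in> W - {0} \<and> lead_pos k (B q) = q"
    by metis
  have "A \<in> mspace.span (B ` ?P)" if "A \<in> W" for A
    using that
  proof (induction "Max (range k) - k (lead_pos k A)" arbitrary: A rule: less_induct)
    case less
    show ?case
    proof (cases "A = 0")
      case True
      then show ?thesis
        by (simp add: mspace.span_zero)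
    next
      case False
      obtain i j where q: "lead_pos k A = (i, j)"
        by fastforce
      then have P: "(i, j) \<in> ?P"
        using False less.prems by (metis Diff_iff imageI singletonD)
      let ?B = "B (i, j)"
      define C where "C = A - mscale (A $ i $ j / ?B $ i $ j) ?B"
      have CW: "C \<in> W"
        unfolding C_def using B[OF P] less.prems W
        by (simp add: mspace.subspace_diff mspace.subspace_scale)
      have "C \<in> mspace.span (B ` ?P)"
      proof (cases "C = 0")
        case True
        then show ?thesis
          by (simp add: mspace.span_zero)
      next
        case nz: False
        have B0: "?B $ i $ j \<noteq> 0"
          using lead_pos(1)[of ?B k] B[OF P] by simp
        have "C $ i' $ j' = 0" if "k (i', j') \<le> k (i, j)" for i' j'
        proof (cases "(i', j') = (i, j)")
          case True
          then show ?thesis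
            using B0 by (simp add: C_def mscale_def)
        next
          case ne: False
          then have "k (i', j') < k (i, j)"
            using that \<open>inj k\<close> by (metis inj_eq le_neq_implies_less)
          then show ?thesis
            using lead_pos(2)[OF False, of k i' j'] lead_pos(2)[of ?B k i' j'] B[OF P] q
            by (simp add: C_def mscale_def)
        qed
        then have "k (i, j) < k (lead_pos k C)"
          using lead_pos(1)[OF nz, of k] by (metis not_le_imp_less prod.collapse)
        moreover have "k (lead_pos k C) \<le> Max (range k)"
          by simp
        ultimately have "Max (range k) - k (lead_pos k C) < Max (range k) - k (lead_pos k A)"
          unfolding q by linarith
        then show ?thesis
          using CW by (rule less.hyps)
      qed
      then have "C + mscale (A $ i $ j / ?B $ i $ j) ?B \<in> mspace.span (B ` ?P)"
        by (rule mspace.span_add) (intro mspace.span_scale mspace.span_base imageI P)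
      then show ?thesis
        by (simp add: C_def)
    qed
  qed
  then have "mspace.dim W \<le> card (B ` ?P)"
    by (intro mspace.dim_le_card) auto
  also have "\<dots> \<le> card ?P"
    by (rule card_image_le) simp
  finally show ?thesis .
qed

text \<open>With low digit below the base \<open>N\<close>, comparing keys \<open>a * N + c\<close>
  refines comparing the high digits; this makes the key below lexicographic.\<close>

lemma lex_key_less:
  fixes a b c d N :: nat
  assumes "a < b" "c < N"
  shows "a * N + c < b * N + d"
proof -
  have "a * N + c < Suc a * N"
    using assms(2) by simp
  also have "\<dots> \<le> b * N"
    using assms(1) by (intro mult_le_mono1) simp
  finally show ?thesis
    by simp
qed

lemma exists_subgraph_of_bounded_rank_space:
  fixes E :: "('m::finite \<times> 'n::finite) set" and W :: "('a::field ^ 'n ^ 'm) set"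
  assumes W: "mspace.subspace W" "W \<subseteq> graph_space E" "\<forall>A\<in>W. rank A \<le> r"
  shows "\<exists>H\<subseteq>E. matching_number H \<le> r \<and> mspace.dim W \<le> card H"
proof -
  obtain h :: "'m \<Rightarrow> nat" where h: "inj h"
    using finite_imp_inj_to_nat_seg[of "UNIV :: 'm set"] by auto
  obtain g :: "'n \<Rightarrow> nat" and N where g: "range g = {i. i < N}" "inj g"
    using finite_imp_inj_to_nat_seg[of "UNIV :: 'n set"] by auto
  have gN: "g j < N" for j
    using g(1) by blast
  \<comment> \<open>Rows are compared first, so a matrix leading in row \<open>s\<close> vanishes on
    all rows that precede \<open>s\<close> under \<open>h\<close>.\<close>
  define k where "k = (\<lambda>(i, j). h i * N + g j)"
  have less: "k (i, j) < k (i', j')" if "h i < h i' \<or> (i = i' \<and> g j < g j')" for i j i' j'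
    using that lex_key_less[of "h i" "h i'" "g j" N "g j'"] gN by (auto simp: k_def)
  have "inj k"
  proof (rule injI)
    fix p q :: "'m \<times> 'n" assume "k p = k q"
    moreover obtain i j i' j' where "p = (i, j)" "q = (i', j')"
      by fastforce
    ultimately show "p = q"
      using less[of i i' j j'] less[of i' i j' j] h g(2)
      by (metis inj_eq linorder_neqE_nat less_irrefl)
  qed
  define H where "H = lead_pos k ` (W - {0})"
  have "H \<subseteq> E"
  proof
    fix q assume "q \<in> H"
    then obtain A where A: "A \<in> W" "A \<noteq> 0" "q = lead_pos k A"
      by (auto simp: H_def)
    have "(fst q, snd q) \<in> E"
      using graph_space_support[of A E] lead_pos(1)[OF A(2), of k] A W(2) by blast
    then show "q \<in> E"
      by simp
  qed
  moreover have "card M \<le> r" if M: "matching_in M H" for M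
  proof -
    define R where "R = fst ` M"
    have inj: "inj_on fst M" "inj_on snd M" and MH: "M \<subseteq> H"
      using M by (auto simp: matching_in_iff)
    have "\<exists>j. (i, j) \<in> M" if "i \<in> R" for i
      using that by (auto simp: R_def)
    then obtain c where c: "\<And>i. i \<in> R \<Longrightarrow> (i, c i) \<in> M"
      by metis
    have "inj_on c R"
      using c inj(2) by (metis Pair_inject inj_onD inj_onI snd_conv)
    have "\<exists>A. A \<in> W \<and> A \<noteq> 0 \<and> lead_pos k A = (i, c i)" if "i \<in> R" for i
      using c[OF that] MH by (force simp: H_def)
    then obtain A where A: "\<And>i. i \<in> R \<Longrightarrow> A i \<in> W \<and> A i \<noteq> 0 \<and> lead_pos k (A i) = (i, c i)"
      by metis
    \<comment> \<open>The first alternative gives the vanishing earlier rows for the subset sum, the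
      second the echelon form of the rows \<open>A i $ i\<close>.\<close>
    have zero: "A s $ i $ j = 0" if "s \<in> R" "h i < h s \<or> (i = s \<and> g j < g (c s))" for s i j
      using lead_pos(2)[of "A s" k i j] A[OF that(1)] less[OF that(2)] by simp
    have "inj_on (\<lambda>i. A i $ i) R \<and> vec.independent ((\<lambda>i. A i $ i) ` R)"
    proof (rule echelon_independent[OF _ g(2) \<open>inj_on c R\<close>])
      show "A i $ i $ c i \<noteq> 0" if "i \<in> R" for i
        using lead_pos(1)[of "A i" k] A[OF that] by simp
    qed (use zero in auto)
    then obtain X where X: "X \<subseteq> R" "inj_on (($) (sum A X)) R" "vec.independent (($) (sum A X) ` R)"
      using subset_sum_independent_rows[OF h, of R A] zero by (auto simp: vec_eq_iff)
    have "sum A X \<in> W"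
      using A X(1) W(1) by (intro mspace.subspace_sum) auto
    \<comment> \<open>The subset sum stays in \<open>W\<close>, so the rank bound applies to
      it.\<close>
    then have "card R \<le> r"
      using card_le_rank[OF X(2,3)] W(3) by force
    then show ?thesis
      using inj(1) by (simp add: R_def card_image)
  qed
  moreover have "mspace.dim W \<le> card H"
    unfolding H_def using W(1) \<open>inj k\<close> by (rule dim_le_card_lead_pos)
  ultimately show ?thesis
    using matching_number_le_iff by blast
qed

theorem theorem1p5:
  fixes E :: "('m::finite \<times> 'n::finite) set"
    and r :: nat
  assumes "CARD('m) \<le> CARD('n)"
    and "r \<in> {1..CARD('m)}"
  shows "Max {card H | H. spanning_subgraph H E \<and> matching_number H \<le> r}
       = Max {mspace.dim W | W :: ('a::field ^ 'n ^ 'm) set.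
                mspace.subspace W \<and> W \<subseteq> graph_space E \<and> (\<forall>A\<in>W. rank A \<le> r)}"
    (is "Max ?S = Max ?D")
proof (rule antisym)
  note S = subgraph_sizes_finite_nonempty[of E r]
  note D = bounded_rank_dims_finite_nonempty[of E r, where 'a = 'a]
  \<comment> \<open>Each admissible edge count is itself a dimension, attained by
    \<open>graph_space H\<close>.\<close>
  have "?S \<subseteq> ?D"
  proof clarify
    fix H assume H: "spanning_subgraph H E" "matching_number H \<le> r"
    let ?W = "graph_space H :: ('a ^ 'n ^ 'm) set"
    have "mspace.subspace ?W"
      unfolding graph_space_def by (rule mspace.subspace_span)
    moreover have "?W \<subseteq> graph_space E"
      unfolding graph_space_def using H(1) by (intro mspace.span_mono) (auto simp: spanning_subgraph_def)
    moreover have "\<forall>A\<in>?W. rank A \<le> r"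
      using rank_le_matching_number graph_space_support H(2) by (metis order_trans)
    ultimately show "\<exists>W :: ('a ^ 'n ^ 'm) set. card H = mspace.dim W \<and> mspace.subspace W \<and>
        W \<subseteq> graph_space E \<and> (\<forall>A\<in>W. rank A \<le> r)"
      by (intro exI[of _ ?W]) (simp add: dim_graph_space)
  qed
  then show "Max ?S \<le> Max ?D"
    using S(2) D(1) by (rule Max_mono)
  show "Max ?D \<le> Max ?S"
  proof (rule Max.boundedI[OF D])
    fix d assume "d \<in> ?D"
    then obtain W :: "('a ^ 'n ^ 'm) set" where "d = mspace.dim W"
      and W: "mspace.subspace W" "W \<subseteq> graph_space E" "\<forall>A\<in>W. rank A \<le> r"
      by auto
    then obtain H where "H \<subseteq> E" "matching_number H \<le> r" "d \<le> card H"
      using exists_subgraph_of_bounded_rank_space[OF W] by auto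
    then show "d \<le> Max ?S"
      by (intro Max.coboundedI[OF S(1), THEN order_trans[rotated]]) (auto simp: spanning_subgraph_def)
  qed
qed

end
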